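(* Let $N\ge3$ be an integer and $N-1<\alpha\le N$. Then the stability region of $$\Delta^{\alpha}x(t)=(c-1)\,x(t+\alpha-N),\qquad t\in\mathbb{N}_{N-\alpha},\qquad x(i)=x_i\ \ (0\le i\le N-1),$$ is empty; that is, the zero solution is not asymptotically stable for any $c\in\mathbb{C}$.
   Context: Notation: $\mathbb{N}_0=\{0,1,2,\dots\}$, $\mathbb{N}_r=\{r,r+1,\dots\}$. The unknown is a sequence $x:\mathbb{N}_0\to\mathbb{C}$. Fractional sum of order $\nu>0$: $(\Delta^{-\nu}x)(t)=\frac{1}{\Gamma(\nu)}\sum_{s=0}^{n}\frac{\Gamma(n-s+\nu)}{\Gamma(n-s+1)}x(s)$ for $t=\nu+n$, $n\in\mathbb{N}_0$. Caputo-like difference of order $\alpha$, $N-1<\alpha<N$: $\Delta^{\alpha}x(t)=\Delta^{-(N-\alpha)}(\Delta^N x)(t)$, $t\in\mathbb{N}_{N-\alpha}$, where $\Delta^N x(t)=\sum_{k=0}^N\binom{N}{k}(-1)^{N-k}x(t+k)$; for $\alpha=N$ it is the ordinary $N$th forward difference. Explicitly, with $\tilde\phi_\mu(n)=\binom{n+\mu-1}{n}$ for $n\in\mathbb{N}_0$ (so $\tilde\phi_0(0)=1$, $\tilde\phi_0(n)=0$ for $n\ge1$), the equation (with $t=N-\alpha+n$) reads $$\sum_{s=0}^{n}\tilde\phi_{N-\alpha}(n-s)\,\Delta^Nx(s)=(c-1)x(n),\qquad n\in\mathbb{N}_0.$$ Asymptotic stability of the zero solution has its standard meaning with respect to the initial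 data $(x(0),\dots,x(N-1))$: it is stable and attractive, i.e. solutions tend to $0$ as $n\to\infty$. The stability region is the set of $c\in\mathbb{C}$ for which the zero solution is asymptotically stable. *)

theory Defs
  imports "HOL-Analysis.Analysis"
begin

definition fwd_diff :: "nat \<Rightarrow> (nat \<Rightarrow> complex) \<Rightarrow> nat \<Rightarrow> complex" where
  "fwd_diff N x t = (\<Sum>k\<le>N. of_nat (N choose k) * (- 1) ^ (N - k) * x (t + k))"

(* The fractional sum of order \<nu> > 0 lives on the shifted grid \<nu> + n, n = 0, 1, 2, ...;
   frac_sum \<nu> x n is its value at t = \<nu> + n. *)
definition frac_sum :: "real \<Rightarrow> (nat \<Rightarrow> complex) \<Rightarrow> nat \<Rightarrow> complex" where
  "frac_sum \<nu> x n =
     of_real (1 / Gamma \<nu>) *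
     (\<Sum>s = 0..n. of_real (Gamma (real n - real s + \<nu>) / Gamma (real n - real s + 1)) * x s)"

(* Caputo-like difference of order \<alpha>, meant for N - 1 < \<alpha> \<le> N, evaluated at t = N - \<alpha> + n.
   The case \<alpha> = N has to be separate: frac_sum 0 is identically 0, because Gamma 0 = 0
   and 1 / 0 = 0 in HOL. *)
definition caputo_diff :: "nat \<Rightarrow> real \<Rightarrow> (nat \<Rightarrow> complex) \<Rightarrow> nat \<Rightarrow> complex" where
  "caputo_diff N \<alpha> x n =
     (if \<alpha> = real N then fwd_diff N x n else frac_sum (real N - \<alpha>) (fwd_diff N x) n)"

(* With t = N - \<alpha> + n, the delayed argument t + \<alpha> - N is n. Only a 0, ..., a (N - 1) matter. *)
definition solves_ivp ::
    "nat \<Rightarrow> real \<Rightarrow> complex \<Rightarrow> (nat \<Rightarrow> complex) \<Rightarrow> (nat \<Rightarrow> complex) \<Rightarrow> bool" where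
  "solves_ivp N \<alpha> c a x \<longleftrightarrow>
     (\<forall>n. caputo_diff N \<alpha> x n = (c - 1) * x n) \<and> (\<forall>i<N. x i = a i)"

definition zero_stable :: "nat \<Rightarrow> real \<Rightarrow> complex \<Rightarrow> bool" where
  "zero_stable N \<alpha> c \<longleftrightarrow>
     (\<forall>\<epsilon>>0. \<exists>\<delta>>0. \<forall>a x. solves_ivp N \<alpha> c a x \<longrightarrow> (\<forall>i<N. norm (a i) < \<delta>) \<longrightarrow>
        (\<forall>n. norm (x n) < \<epsilon>))"

(* Local attractivity; as the equation is linear, this is the same as all solutions tending to 0. *)
definition zero_attractive :: "nat \<Rightarrow> real \<Rightarrow> complex \<Rightarrow> bool" where
  "zero_attractive N \<alpha> c \<longleftrightarrow>
     (\<exists>\<eta>>0. \<forall>a x. solves_ivp N \<alpha> c a x \<longrightarrow> (\<forall>i<N. norm (a i) < \<eta>) \<longrightarrow>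
        x \<longlonglongrightarrow> 0)"

definition zero_asymptotically_stable :: "nat \<Rightarrow> real \<Rightarrow> complex \<Rightarrow> bool" where
  "zero_asymptotically_stable N \<alpha> c \<longleftrightarrow> zero_stable N \<alpha> c \<and> zero_attractive N \<alpha> c"

definition stability_region :: "nat \<Rightarrow> real \<Rightarrow> complex set" where
  "stability_region N \<alpha> = {c. zero_asymptotically_stable N \<alpha> c}"

end

theory Submission
  imports Defs
begin

text \<open>
  Write \<open>b = c - 1\<close> and let \<open>F\<close> be the generating function of the solution with
  \<open>x(0) = \<dots> = x(N - 2) = 0\<close> and \<open>x(N - 1) = \<eta>\<close>. The equation becomes
  \<open>F(z) ((1 - z)\<^sup>\<alpha> - b z\<^sup>N) = \<eta> z\<^bsup>N-1\<^esup> (1 - z)\<^bsup>\<alpha>-N\<^esup>\<close>. If \<open>b \<noteq> 0\<close> and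
  \<open>\<alpha> > 2\<close>, the bracket has a zero \<open>z \<noteq> 0\<close> in the open unit disc while the right-hand side does not
  vanish there, so \<open>F\<close> cannot converge in the whole disc and the solution is unbounded.
  If \<open>b = 0\<close>, constants are solutions.

  The zero is found by the intermediate value theorem along the curve on which
  \<open>(1 - z)\<^sup>\<alpha> / z\<^sup>N\<close> has the argument of \<open>b\<close>. In the triangle with vertices \<open>0\<close>, \<open>1\<close>, \<open>z\<close>
  and angles \<open>A\<close> at \<open>0\<close> and \<open>B\<close> at \<open>1\<close> this argument is \<open>- (\<alpha> B + N A)\<close>, so the curve is
  explicit in \<open>B\<close>, and since \<open>\<alpha> > 2\<close> it keeps \<open>A + B < \<pi> / 2\<close>, which forces \<open>|z| < 1\<close>.
\<close>

section \<open>Zeros of \<open>(1 - z) powr \<alpha> - b * z ^ N\<close> in the unit disc\<close>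

text \<open>By the law of sines, the two summands divided by the right-hand side are the sides
  \<open>z\<close> and \<open>1 - z\<close> of the triangle with vertices 0, 1, z.\<close>

lemma complex_triangle_sin:
  "of_real (sin B) * cis A + of_real (sin A) * cis (- B) = of_real (sin (A + B))"
  by (simp add: complex_eq_iff sin_add algebra_simps)

text \<open>For positive \<open>b\<close> the triangle degenerates to a segment, and the
  intermediate value theorem applies on the real interval from 0 to 1.\<close>

lemma root_in_unit_disc_arg_zero:
  fixes N :: nat and \<alpha> r :: real
  assumes N: "N > 0" and \<alpha>: "\<alpha> > 0" and r: "r > 0"
  shows "\<exists>z::complex. norm z < 1 \<and> (1 - z) powr of_real \<alpha> = of_real r * z ^ N"
proof -
  define f where "f t = r * t ^ N - (1 - t) powr \<alpha>" for t :: real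
  have "continuous_on {0..1} f"
    unfolding f_def using \<alpha> by (intro continuous_intros continuous_on_powr') auto
  moreover have "f 0 \<le> 0" "0 \<le> f 1"
    using N r by (simp_all add: f_def power_0_left)
  ultimately obtain t where t: "0 \<le> t" "t \<le> 1" "f t = 0"
    using IVT'[of f 0 0 1] by auto
  have "t \<noteq> 1" using t r by (auto simp: f_def)
  hence "t < 1" using t by simp
  have "(1 - complex_of_real t) powr of_real \<alpha> = of_real ((1 - t) powr \<alpha>)"
    using t powr_of_real[of "1 - t" \<alpha>] by simp
  also have "\<dots> = of_real r * of_real t ^ N"
    using t(3) by (simp add: f_def flip: of_real_power of_real_mult)
  finally show ?thesis
    using t \<open>t < 1\<close> by (intro exI[of _ "of_real t"]) simp
qed

lemma root_in_unit_disc_arg_neg: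
  fixes N :: nat and \<alpha> r \<phi> :: real
  assumes \<alpha>: "2 < \<alpha>" "\<alpha> \<le> real N" and r: "r > 0" and \<phi>: "0 < \<phi>" "\<phi> \<le> pi"
  shows "\<exists>z::complex. norm z < 1 \<and> (1 - z) powr of_real \<alpha> = of_real r * cis (- \<phi>) * z ^ N"
proof -
  have N: "real N > 2" "N > 0" using \<alpha> by (auto intro: Nat.gr0I)
  \<comment> \<open>The argument condition \<open>\<alpha> * B + N * A = \<phi>\<close> solved for
    the angle at 0, so that \<open>B\<close> alone parametrises the curve.\<close>
  define A where "A B = (\<phi> - \<alpha> * B) / N" for B
  \<comment> \<open>What remains is the modulus equation
    \<open>(sin A / S) powr \<alpha> = r * (sin B / S) ^ N\<close> with
    \<open>S = sin (A + B)\<close>, here multiplied by \<open>S ^ N\<close>. The curve runs from z =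
    0 at \<open>B = 0\<close> to z = 1 at \<open>B = \<phi> / \<alpha>\<close>.\<close>
  define f where
    "f B = r * sin B ^ N - sin (A B) powr \<alpha> * sin (A B + B) powr (N - \<alpha>)" for B
  \<comment> \<open>The bound \<alpha> > 2 enters here, against \<phi> \<le> pi.\<close>
  have \<phi>\<alpha>: "0 < \<phi> / \<alpha>" "\<phi> / \<alpha> < pi / 2"
  proof -
    show "0 < \<phi> / \<alpha>" using \<alpha> \<phi> by simp
    have "\<phi> * 2 < pi * \<alpha>" using \<alpha> \<phi> by (intro mult_le_less_imp_less) auto
    thus "\<phi> / \<alpha> < pi / 2" using \<alpha> by (simp add: field_simps)
  qed
  have range: "0 \<le> A B" "A B + B \<le> \<phi> / \<alpha>" "0 < A B + B"
    if B: "0 \<le> B" "B \<le> \<phi> / \<alpha>" for B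
  proof -
    have "\<alpha> * B \<le> \<phi>" using B \<alpha> by (simp add: field_simps)
    thus "0 \<le> A B" by (simp add: A_def)
    \<comment> \<open>The sum is affine in \<open>B\<close> with slope
      \<open>1 - \<alpha> / N \<ge> 0\<close>, so it is largest at the right endpoint, where
      \<open>A\<close> vanishes.\<close>
    have "A B + B = (\<phi> + (N - \<alpha>) * B) / N"
      using N by (simp add: A_def field_simps)
    also have "\<dots> \<le> (\<phi> + (N - \<alpha>) * (\<phi> / \<alpha>)) / N"
      using B \<alpha> by (intro divide_right_mono add_left_mono mult_left_mono) auto
    also have "\<dots> = \<phi> / \<alpha>" using \<alpha> N by (simp add: field_simps)
    finally show "A B + B \<le> \<phi> / \<alpha>" .
    have "A 0 > 0" using \<phi> N by (simp add: A_def)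
    thus "0 < A B + B" using B \<open>0 \<le> A B\<close> by (cases "B = 0") auto
  qed
  have sinA: "0 \<le> sin (A B)" and sinS: "0 < sin (A B + B)"
    if B: "0 \<le> B" "B \<le> \<phi> / \<alpha>" for B
  proof -
    show "0 < sin (A B + B)"
      using range[OF B] \<phi>\<alpha> pi_gt_zero by (intro sin_gt_zero; linarith)
    show "0 \<le> sin (A B)"
      using range[OF B] \<phi>\<alpha> B pi_gt_zero by (intro sin_ge_zero; linarith)
  qed
  have "continuous_on {0..\<phi> / \<alpha>} f"
  proof -
    have A: "continuous_on {0..\<phi> / \<alpha>} A"
      unfolding A_def using N by (intro continuous_intros) auto
    have "\<forall>B\<in>{0..\<phi> / \<alpha>}. 0 \<le> sin (A B) \<and> (sin (A B) = 0 \<longrightarrow> 0 < \<alpha>)"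
      using sinA \<alpha> by auto
    hence "continuous_on {0..\<phi> / \<alpha>} (\<lambda>B. sin (A B) powr \<alpha>)"
      by (intro continuous_on_powr' continuous_on_sin continuous_on_const A)
    \<comment> \<open>The exponent \<open>N - \<alpha>\<close> may be 0 and \<open>0 powr 0\<close>
      is 0, so this base has to be nonzero; \<open>sin (A B)\<close> may vanish because its exponent
      is positive.\<close>
    moreover have "\<forall>B\<in>{0..\<phi> / \<alpha>}. sin (A B + B) \<noteq> 0"
      using sinS by force
    hence "continuous_on {0..\<phi> / \<alpha>} (\<lambda>B. sin (A B + B) powr (N - \<alpha>))"
      by (intro continuous_on_powr continuous_intros A)
    ultimately show ?thesis
      unfolding f_def
      by (intro continuous_on_diff continuous_on_mult continuous_on_power continuous_on_sin
          continuous_on_const continuous_on_id)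
  qed
  moreover have "f 0 \<le> 0"
    using N by (simp add: f_def power_0_left)
  moreover have "0 \<le> f (\<phi> / \<alpha>)"
  proof -
    have "A (\<phi> / \<alpha>) = 0" using \<alpha> by (simp add: A_def)
    moreover have "0 \<le> sin (\<phi> / \<alpha>)" using \<phi>\<alpha> pi_gt_zero by (intro sin_ge_zero; linarith)
    ultimately show ?thesis using r by (simp add: f_def)
  qed
  ultimately obtain B where B: "0 \<le> B" "B \<le> \<phi> / \<alpha>" and fB: "f B = 0"
    using IVT'[of f 0 0 "\<phi> / \<alpha>"] \<phi>\<alpha> by auto
  define S where "S = sin (A B + B)"
  define a where "a = A B"
  have S: "S > 0" using sinS[OF B] by (simp add: S_def)
  have sinB0: "0 \<le> sin B" using B \<phi>\<alpha> pi_gt_zero by (intro sin_ge_zero; linarith)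
  have eq: "r * sin B ^ N = sin a powr \<alpha> * S powr (N - \<alpha>)"
    using fB by (simp add: f_def S_def a_def)
  \<comment> \<open>This excludes the endpoint z = 1, where the left side of \<open>eq\<close> is
    positive and the right side is 0.\<close>
  have "a \<noteq> 0"
  proof
    assume "a = 0"
    hence "B = \<phi> / \<alpha>" using \<alpha> N by (simp add: a_def A_def field_simps)
    hence "sin B > 0" using \<phi>\<alpha> pi_gt_zero by (intro sin_gt_zero; linarith)
    thus False using eq r \<open>a = 0\<close> by simp
  qed
  hence a: "0 < a" "a + B \<le> \<phi> / \<alpha>" using range[OF B] by (auto simp: a_def)
  have sina: "0 < sin a" using a B \<phi>\<alpha> pi_gt_zero by (intro sin_gt_zero; linarith)
  \<comment> \<open>Sine increases strictly up to pi/2, and \<open>B < a + B < pi / 2\<close>. The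
    quotient \<open>sin B / S\<close> will be the modulus of z.\<close>
  have "sin B < S"
    unfolding S_def a_def[symmetric] using a B \<phi>\<alpha> pi_gt_zero by (intro sin_monotone_2pi; linarith)
  define z where "z = of_real (sin B / S) * cis a"
  have "norm z < 1"
    using \<open>sin B < S\<close> sinB0 S by (simp add: z_def norm_mult norm_divide)
  have z1: "1 - z = of_real (sin a / S) * cis (- B)"
  proof -
    have "of_real S * z + of_real S * (of_real (sin a / S) * cis (- B)) = of_real S"
      using complex_triangle_sin[of B a] S by (simp add: z_def S_def a_def)
    thus ?thesis using S by (simp add: field_simps)
  qed
  have "(1 - z) powr of_real \<alpha> = of_real ((sin a / S) powr \<alpha>) * cis (- \<alpha> * B)"
  proof -
    have "B < pi" using B \<phi>\<alpha> pi_gt_zero by linarith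
    \<comment> \<open>The imaginary part \<open>- B\<close> lies in (-pi, 0], so this is the
      principal logarithm.\<close>
    have Ln: "Ln (1 - z) = of_real (ln (sin a / S)) + \<i> * of_real (- B)"
    proof (rule Ln_unique)
      show "exp (of_real (ln (sin a / S)) + \<i> * of_real (- B)) = 1 - z"
        unfolding z1 exp_add cis_conv_exp exp_of_real using sina S by simp
    qed (use B(1) \<open>B < pi\<close> in auto)
    have "1 - z \<noteq> 0" using z1 sina S by simp
    hence "(1 - z) powr of_real \<alpha>
        = exp (of_real (\<alpha> * ln (sin a / S)) + \<i> * of_real (- \<alpha> * B))"
      by (simp add: powr_def Ln algebra_simps)
    also have "\<dots> = of_real (exp (\<alpha> * ln (sin a / S))) * cis (- \<alpha> * B)"
      by (simp only: exp_add cis_conv_exp exp_of_real)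
    finally show ?thesis using sina S by (simp add: powr_def)
  qed
  also have "\<dots> = of_real r * cis (- \<phi>) * z ^ N"
  proof -
    have modulus: "(sin a / S) powr \<alpha> = r * (sin B / S) ^ N"
    proof -
      have "r * (sin B / S) ^ N = r * sin B ^ N / S ^ N"
        by (simp add: power_divide)
      also have "\<dots> = sin a powr \<alpha> * (S powr (N - \<alpha>) / S powr N)"
        using S by (simp add: eq powr_realpow)
      also have "S powr (N - \<alpha>) / S powr N = 1 / S powr \<alpha>"
        using S by (simp add: powr_diff)
      finally show ?thesis using sina S by (simp add: powr_divide)
    qed
    have "cis (- \<phi>) * cis a ^ N = cis (- \<alpha> * B)"
    proof -
      have "- \<phi> + real N * a = - \<alpha> * B" using N by (simp add: a_def A_def)
      thus ?thesis by (metis Complex.DeMoivre cis_mult)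
    qed
    hence "of_real ((sin a / S) powr \<alpha>) * cis (- \<alpha> * B)
        = of_real r * of_real (sin B / S) ^ N * (cis (- \<phi>) * cis a ^ N)"
      by (simp only: modulus of_real_mult of_real_power)
    thus ?thesis by (simp only: z_def power_mult_distrib mult_ac)
  qed
  finally show ?thesis using \<open>norm z < 1\<close> by blast
qed

lemma root_in_unit_disc:
  fixes N :: nat and \<alpha> :: real and b :: complex
  assumes \<alpha>: "2 < \<alpha>" "\<alpha> \<le> real N" and b: "b \<noteq> 0"
  shows "\<exists>z. norm z < 1 \<and> (1 - z) powr of_real \<alpha> = b * z ^ N"
proof -
  have N: "N > 0" using \<alpha> by (auto intro: Nat.gr0I)
  define r where "r = norm b"
  have r: "r > 0" using b by (simp add: r_def)
  have b_polar: "b = of_real r * cis (Arg b)"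
    using rcis_cmod_Arg[of b] by (simp add: r_def rcis_def)
  have Arg: "- pi < Arg b" "Arg b \<le> pi" using Arg_bounded by auto
  consider "Arg b = 0" | "Arg b < 0" | "Arg b > 0" by linarith
  thus ?thesis
  proof cases
    case 1
    thus ?thesis using root_in_unit_disc_arg_zero[OF N _ r, of \<alpha>] b_polar \<alpha> by simp
  next
    case 2
    thus ?thesis using root_in_unit_disc_arg_neg[OF \<alpha> r, of "- Arg b"] b_polar Arg by simp
  next
    case 3
    then obtain z where z: "norm z < 1"
        "(1 - z) powr of_real \<alpha> = of_real r * cis (- Arg b) * z ^ N"
      using root_in_unit_disc_arg_neg[OF \<alpha> r, of "Arg b"] Arg by auto
    \<comment> \<open>This keeps \<open>1 - z\<close> off the branch cut, so \<open>powr\<close>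
      commutes with conjugation and the root for \<open>cnj b\<close> yields one for
      \<open>b\<close>.\<close>
    have "Re z < 1" using z(1) complex_Re_le_cmod[of z] by simp
    hence "(1 - cnj z) powr of_real \<alpha> = cnj ((1 - z) powr of_real \<alpha>)"
      by (subst cnj_powr) auto
    also have "\<dots> = b * cnj z ^ N"
      unfolding z(2) by (subst b_polar) (simp add: cis_cnj)
    finally show ?thesis using z(1) by (intro exI[of _ "cnj z"]) simp
  qed
qed

section \<open>Forward differences of power series\<close>

lemma fwd_diff_const:
  assumes "N > 0"
  shows "fwd_diff N (\<lambda>_. \<eta>) n = 0"
proof -
  have "fwd_diff N (\<lambda>_. \<eta>) n = (\<Sum>k\<le>N. of_nat (N choose k) * 1 ^ k * (- 1) ^ (N - k)) * \<eta>"
    by (simp add: fwd_diff_def sum_distrib_right)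
  also have "\<dots> = (1 + (- 1)) ^ N * \<eta>"
    by (subst binomial_ring) simp
  finally show ?thesis using assms by simp
qed

text \<open>Since the coefficients of \<open>F\<close> below \<open>m\<close> vanish, shifting by at
  most \<open>m\<close> places loses nothing; only the shift by \<open>Suc m\<close> drops a term,
  the leading one. The binomial theorem then collects the shifts.\<close>

lemma fps_fwd_diff:
  fixes F G :: "complex fps"
  assumes F: "F = G * fps_X ^ m"
  shows "fps_X ^ Suc m * Abs_fps (fwd_diff (Suc m) (fps_nth F))
           = (1 - fps_X) ^ Suc m * F - fps_const (fps_nth G 0) * fps_X ^ m"
proof -
  define N where "N = Suc m"
  have shift: "fps_X ^ N * fps_shift k F
      = fps_X ^ (N - k) * F - (if k = N then fps_const (fps_nth G 0) * fps_X ^ m else 0)"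
    if "k \<le> N" for k
  proof (cases "k = N")
    case True
    have "fps_shift N F = fps_shift 1 G"
      unfolding F N_def by (subst fps_shift_times_fps_X_power'') auto
    moreover have "fps_X * fps_shift 1 G = G - fps_const (fps_nth G 0)"
      by (intro fps_ext) auto
    hence "fps_X ^ N * fps_shift 1 G = G * fps_X ^ m - fps_const (fps_nth G 0) * fps_X ^ m"
      by (metis N_def left_diff_distrib mult.assoc mult.commute power_Suc)
    ultimately show ?thesis
      using True by (simp add: N_def F mult_ac)
  next
    case False
    hence k: "k \<le> m" using that by (simp add: N_def)
    have "fps_shift k F = G * fps_X ^ (m - k)"
      using k by (cases "k = m") (auto simp: F fps_shift_times_fps_X_power''')
    moreover have "N + (m - k) = (N - k) + m" using k by (simp add: N_def)
    hence "fps_X ^ N * fps_X ^ (m - k) = (fps_X ^ (N - k) * fps_X ^ m :: complex fps)"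
      by (simp flip: power_add)
    ultimately show ?thesis using False by (simp add: F mult_ac)
  qed
  have "Abs_fps (fwd_diff N (fps_nth F))
      = (\<Sum>k\<le>N. fps_const (of_nat (N choose k) * (- 1) ^ (N - k)) * fps_shift k F)"
    by (intro fps_ext) (simp add: fwd_diff_def fps_sum_nth)
  hence "fps_X ^ N * Abs_fps (fwd_diff N (fps_nth F))
      = (\<Sum>k\<le>N. fps_const (of_nat (N choose k) * (- 1) ^ (N - k)) * (fps_X ^ N * fps_shift k F))"
    by (simp add: sum_distrib_left mult_ac)
  also have "\<dots> = (\<Sum>k\<le>N. fps_const (of_nat (N choose k) * (- 1) ^ (N - k)) * fps_X ^ (N - k) * F
      - (if k = N then fps_const (fps_nth G 0) * fps_X ^ m else 0))"
    by (intro sum.cong refl, subst shift) (auto simp: right_diff_distrib' mult.assoc)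
  also have "\<dots> = (\<Sum>k\<le>N. fps_const (of_nat (N choose k) * (- 1) ^ (N - k)) * fps_X ^ (N - k)) * F
      - fps_const (fps_nth G 0) * fps_X ^ m"
    by (simp add: sum_subtractf sum_distrib_right)
  also have "(\<Sum>k\<le>N. fps_const (of_nat (N choose k) * (- 1) ^ (N - k)) * fps_X ^ (N - k))
      = (\<Sum>k\<le>N. of_nat (N choose k) * 1 ^ k * (- fps_X) ^ (N - k) :: complex fps)"
  proof (intro sum.cong refl)
    fix k
    have "fps_const ((- 1) ^ (N - k)) = ((- 1) ^ (N - k) :: complex fps)"
      by (simp flip: fps_const_power fps_const_neg)
    thus "fps_const (of_nat (N choose k) * (- 1) ^ (N - k)) * fps_X ^ (N - k)
        = (of_nat (N choose k) * 1 ^ k * (- fps_X) ^ (N - k) :: complex fps)"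
      by (simp add: fps_of_nat power_minus[of fps_X] mult_ac flip: fps_const_mult)
  qed
  also have "\<dots> = (1 - fps_X) ^ N"
    using binomial_ring[of 1 "- fps_X :: complex fps" N] by simp
  finally show ?thesis by (simp add: N_def)
qed

section \<open>The fractional sum as a convolution\<close>

text \<open>The power series of \<open>(1 - z) powr (- \<beta>)\<close>. Unlike the Gamma quotient,
  the Pochhammer form is also right at \<beta> = 0, where it gives the series 1; this covers
  \<alpha> = N uniformly.\<close>

definition frac_kernel :: "real \<Rightarrow> complex fps" where
  "frac_kernel \<beta> = Abs_fps (\<lambda>n. of_real (pochhammer \<beta> n / fact n))"

lemma frac_kernel_0 [simp]: "frac_kernel 0 = 1"
  by (intro fps_ext) (simp add: frac_kernel_def pochhammer_0_left)

lemma frac_kernel_nth_0 [simp]: "fps_nth (frac_kernel \<beta>) 0 = 1"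
  by (simp add: frac_kernel_def)

lemma frac_sum_eq_fps_nth:
  assumes "\<beta> > 0"
  shows "frac_sum \<beta> x n = fps_nth (frac_kernel \<beta> * Abs_fps x) n"
proof -
  have "Gamma (real n - real s + \<beta>) / Gamma (real n - real s + 1) / Gamma \<beta>
      = pochhammer \<beta> (n - s) / fact (n - s)" if "s \<le> n" for s
  proof -
    have "\<beta> \<notin> \<int>\<^sub>\<le>\<^sub>0" using assms nonpos_Ints_nonpos by fastforce
    hence "pochhammer \<beta> (n - s) = Gamma (\<beta> + of_nat (n - s)) / Gamma \<beta>"
      by (rule pochhammer_Gamma)
    moreover have "Gamma (real n - real s + 1) = fact (n - s)"
      using that Gamma_fact[of "n - s", where 'a = real] by (simp add: of_nat_diff add_ac)
    ultimately show ?thesis using that by (simp add: of_nat_diff add_ac)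
  qed
  hence kernel: "of_real (1 / Gamma \<beta>) *
        (of_real (Gamma (real n - real s + \<beta>) / Gamma (real n - real s + 1)) * x s)
      = of_real (pochhammer \<beta> (n - s) / fact (n - s)) * x s" if "s \<le> n" for s
    using that by (metis (no_types) divide_inverse inverse_eq_divide mult.assoc mult.commute of_real_mult)
  have "frac_sum \<beta> x n = (\<Sum>s = 0..n. of_real (pochhammer \<beta> (n - s) / fact (n - s)) * x s)"
    unfolding frac_sum_def sum_distrib_left
    by (intro sum.cong refl kernel) simp
  also have "\<dots> = fps_nth (Abs_fps x * frac_kernel \<beta>) n"
    by (simp add: fps_mult_nth frac_kernel_def mult.commute)
  finally show ?thesis by (simp add: mult.commute)
qed

lemma caputo_diff_eq_fps_nth:
  assumes "\<alpha> \<le> real N"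
  shows "caputo_diff N \<alpha> x n = fps_nth (frac_kernel (real N - \<alpha>) * Abs_fps (fwd_diff N x)) n"
  using assms by (simp add: caputo_diff_def frac_sum_eq_fps_nth)

text \<open>Newton's binomial series with exponent \<open>- \<beta>\<close> at \<open>- z\<close>;
  the two alternating signs cancel.\<close>

lemma sums_frac_kernel:
  assumes "norm z < 1"
  shows "(\<lambda>n. fps_nth (frac_kernel \<beta>) n * z ^ n) sums (1 - z) powr (- of_real \<beta>)"
proof -
  have "(\<lambda>n. (- complex_of_real \<beta> gchoose n) * (- z) ^ n) sums (1 + - z) powr (- of_real \<beta>)"
    using assms by (intro gen_binomial_complex) simp
  moreover have "(- complex_of_real \<beta> gchoose n) * (- z) ^ n = fps_nth (frac_kernel \<beta>) n * z ^ n" for n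
  proof -
    have "(- 1) ^ n * (- z) ^ n = z ^ n" by (simp flip: power_mult_distrib)
    thus ?thesis
      by (simp add: gbinomial_pochhammer frac_kernel_def pochhammer_of_real mult_ac)
  qed
  ultimately show ?thesis by simp
qed

section \<open>Radius of convergence at least 1\<close>

lemma one_le_fps_conv_radiusI:
  fixes F :: "complex fps"
  assumes "\<And>z. norm z < 1 \<Longrightarrow> summable (\<lambda>n. fps_nth F n * z ^ n)"
  shows "1 \<le> fps_conv_radius F"
  unfolding fps_conv_radius_def
  by (rule conv_radius_geI_ex') (auto intro!: assms)

lemma one_le_fps_conv_radius_bounded:
  fixes F :: "complex fps"
  assumes "Bseq (fps_nth F)"
  shows "1 \<le> fps_conv_radius F"
proof (rule one_le_fps_conv_radiusI)
  fix z :: complex assume z: "norm z < 1"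
  obtain K where K: "\<And>n. norm (fps_nth F n) \<le> K" using assms by (metis BseqE)
  have "summable (\<lambda>n. K * norm z ^ n)" using z by (intro summable_mult summable_geometric) simp
  thus "summable (\<lambda>n. fps_nth F n * z ^ n)"
    by (rule summable_comparison_test')
       (simp add: norm_mult norm_power mult_right_mono K)
qed

lemma fps_conv_radius_mult_geI:
  fixes F G :: "complex fps"
  shows "r \<le> fps_conv_radius F \<Longrightarrow> r \<le> fps_conv_radius G \<Longrightarrow> r \<le> fps_conv_radius (F * G)"
  by (rule order.trans[OF _ fps_conv_radius_mult]) simp

lemma fps_conv_radius_diff_geI:
  fixes F G :: "complex fps"
  shows "r \<le> fps_conv_radius F \<Longrightarrow> r \<le> fps_conv_radius G \<Longrightarrow> r \<le> fps_conv_radius (F - G)"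
  by (rule order.trans[OF _ fps_conv_radius_diff]) simp

lemma fps_conv_radius_power_geI:
  fixes F :: "complex fps"
  shows "r \<le> fps_conv_radius F \<Longrightarrow> r \<le> fps_conv_radius (F ^ n)"
  by (rule order.trans[OF _ fps_conv_radius_power])

section \<open>An unbounded solution for c \<noteq> 1\<close>

lemma exists_unbounded_solution:
  assumes \<alpha>: "2 < \<alpha>" "\<alpha> \<le> real N" and c: "c \<noteq> 1" and \<eta>: "\<eta> \<noteq> 0"
  shows "\<exists>x. solves_ivp N \<alpha> c (\<lambda>i. if i = N - 1 then \<eta> else 0) x \<and> \<not> Bseq x"
proof -
  define b where "b = c - 1"
  have b: "b \<noteq> 0" using c by (simp add: b_def)
  obtain m where N: "N = Suc m" using \<alpha> by (cases N) auto
  define \<Phi> where "\<Phi> = frac_kernel (real N - \<alpha>)"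
  \<comment> \<open>In the disc \<open>Q\<close> represents
    \<open>(1 - z) powr \<alpha> - b * z ^ N\<close>. Its constant term is 1, so it is invertible as
    a formal series, and \<open>F\<close> below is the formal solution of the transformed
    equation.\<close>
  define Q where "Q = (1 - fps_X) ^ N * \<Phi> - fps_const b * fps_X ^ N"
  define G where "G = fps_const \<eta> * \<Phi> * inverse Q"
  define F where "F = G * fps_X ^ m"
  have Q0: "fps_nth Q 0 = 1"
    by (simp add: Q_def \<Phi>_def N fps_power_zeroth)
  have FQ: "F * Q = fps_const \<eta> * fps_X ^ m * \<Phi>"
  proof -
    have "inverse Q * Q = 1" using Q0 by (intro inverse_mult_eq_1) simp
    thus ?thesis by (simp add: F_def G_def mult_ac)
  qed
  have G0: "fps_nth G 0 = \<eta>" by (simp add: G_def Q0 \<Phi>_def)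
  \<comment> \<open>The equation is checked after multiplication by \<open>fps_X ^ N\<close>, which
    can be cancelled.\<close>
  have "\<Phi> * Abs_fps (fwd_diff N (fps_nth F)) = fps_const b * F"
  proof -
    have "fps_X ^ N * (\<Phi> * Abs_fps (fwd_diff N (fps_nth F)))
        = \<Phi> * ((1 - fps_X) ^ N * F - fps_const \<eta> * fps_X ^ m)"
      using fps_fwd_diff[OF F_def] by (simp add: N G0 mult_ac)
    also have "\<dots> = F * ((1 - fps_X) ^ N * \<Phi>) - F * Q"
      by (simp add: FQ algebra_simps)
    also have "\<dots> = fps_X ^ N * (fps_const b * F)"
      by (simp add: Q_def algebra_simps)
    finally show ?thesis by simp
  qed
  hence "caputo_diff N \<alpha> (fps_nth F) n = b * fps_nth F n" for n
    using \<alpha> by (simp add: caputo_diff_eq_fps_nth \<Phi>_def)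
  moreover have "fps_nth F i = (if i = N - 1 then \<eta> else 0)" if "i < N" for i
    using that by (auto simp: F_def fps_X_power_mult_right_nth G0 N)
  ultimately have "solves_ivp N \<alpha> c (\<lambda>i. if i = N - 1 then \<eta> else 0) (fps_nth F)"
    by (simp add: solves_ivp_def b_def)
  moreover have "\<not> Bseq (fps_nth F)"
  proof
    \<comment> \<open>Boundedness makes \<open>F\<close> converge in the whole disc, so
      \<open>FQ\<close> may be evaluated at a zero of \<open>Q\<close>: the left side vanishes, the
      right side does not.\<close>
    assume "Bseq (fps_nth F)"
    hence rF: "1 \<le> fps_conv_radius F" by (rule one_le_fps_conv_radius_bounded)
    have r\<Phi>: "1 \<le> fps_conv_radius \<Phi>"
      unfolding \<Phi>_def using sums_frac_kernel
      by (intro one_le_fps_conv_radiusI) (blast intro: sums_summable)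
    obtain z where z: "norm z < 1" and root: "(1 - z) powr of_real \<alpha> = b * z ^ N"
      using root_in_unit_disc[OF \<alpha> b] by blast
    have "z \<noteq> 1" using z by auto
    \<comment> \<open>At z = 0 the root equation would read 1 = 0.\<close>
    have "z \<noteq> 0" using root N by auto
    have in_disc: "ereal (norm z) < r" if "1 \<le> r" for r
      using z that by (metis ereal_less(3) less_le_trans)
    have r1X: "1 \<le> fps_conv_radius ((1 - fps_X :: complex fps) ^ N)"
      by (intro fps_conv_radius_power_geI fps_conv_radius_diff_geI) simp_all
    have rbX: "1 \<le> fps_conv_radius (fps_const b * fps_X ^ N)"
      by (intro fps_conv_radius_mult_geI) simp_all
    have r1X\<Phi>: "1 \<le> fps_conv_radius ((1 - fps_X) ^ N * \<Phi>)"
      by (intro fps_conv_radius_mult_geI r1X r\<Phi>)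
    have rQ: "1 \<le> fps_conv_radius Q"
      unfolding Q_def by (intro fps_conv_radius_diff_geI r1X\<Phi> rbX)
    have eval_\<Phi>: "eval_fps \<Phi> z = (1 - z) powr of_real (\<alpha> - real N)"
      using sums_frac_kernel[OF z, of "real N - \<alpha>"]
      by (simp add: \<Phi>_def eval_fps_def sums_iff)
    have "eval_fps Q z = (1 - z) ^ N * eval_fps \<Phi> z - b * z ^ N"
    proof -
      have "eval_fps ((1 - fps_X) ^ N) z = (1 - z) ^ N"
        by (subst eval_fps_power)
           (auto simp: eval_fps_diff intro!: in_disc fps_conv_radius_diff_geI)
      thus ?thesis
        unfolding Q_def
        by (simp add: eval_fps_diff eval_fps_mult in_disc r1X\<Phi> r1X r\<Phi> rbX)
    qed
    also have "\<dots> = 0"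
      using \<open>z \<noteq> 1\<close> by (simp add: eval_\<Phi> root[symmetric] powr_diff powr_nat')
    finally have "eval_fps (F * Q) z = 0"
      by (simp add: eval_fps_mult in_disc rF rQ)
    moreover have "eval_fps (F * Q) z = \<eta> * z ^ m * eval_fps \<Phi> z"
    proof -
      have "1 \<le> fps_conv_radius (fps_const \<eta> * fps_X ^ m)"
        by (intro fps_conv_radius_mult_geI) simp_all
      thus ?thesis
        unfolding FQ by (simp add: eval_fps_mult in_disc r\<Phi>)
    qed
    ultimately show False
      using \<eta> \<open>z \<noteq> 0\<close> \<open>z \<noteq> 1\<close> by (simp add: eval_\<Phi>)
  qed
  ultimately show ?thesis by blast
qed

section \<open>Failure of attractivity\<close>

lemma const_solves_ivp:
  assumes "N > 0" and "\<alpha> \<le> real N"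
  shows "solves_ivp N \<alpha> 1 (\<lambda>_. \<eta>) (\<lambda>_. \<eta>)"
proof -
  have "Abs_fps (fwd_diff N (\<lambda>_. \<eta>)) = 0"
    using assms by (intro fps_ext) (simp add: fwd_diff_const)
  thus ?thesis using assms by (simp add: solves_ivp_def caputo_diff_eq_fps_nth)
qed

lemma not_zero_attractive:
  assumes \<alpha>: "2 < \<alpha>" "\<alpha> \<le> real N"
  shows "\<not> zero_attractive N \<alpha> c"
proof
  assume "zero_attractive N \<alpha> c"
  then obtain \<eta> where \<eta>: "\<eta> > 0"
    and attr: "\<And>a x. solves_ivp N \<alpha> c a x \<Longrightarrow> \<forall>i<N. norm (a i) < \<eta> \<Longrightarrow> x \<longlonglongrightarrow> 0"
    unfolding zero_attractive_def by blast
  \<comment> \<open>Half the radius of attraction serves as nonzero admissible initial data in both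
    cases.\<close>
  have small: "norm (complex_of_real (\<eta> / 2)) < \<eta>" "complex_of_real (\<eta> / 2) \<noteq> 0"
    using \<eta> by (simp_all add: norm_divide)
  show False
  proof (cases "c = 1")
    case True
    have "N > 0" using \<alpha> by (auto intro: Nat.gr0I)
    hence "(\<lambda>_::nat. complex_of_real (\<eta> / 2)) \<longlonglongrightarrow> 0"
      using attr[OF const_solves_ivp[folded True]] \<alpha>(2) small(1) by blast
    thus False using small by (simp add: LIMSEQ_const_iff)
  next
    case False
    obtain x where x: "solves_ivp N \<alpha> c (\<lambda>i. if i = N - 1 then of_real (\<eta> / 2) else 0) x"
        "\<not> Bseq x"
      using exists_unbounded_solution[OF \<alpha> False small(2)] by blast
    have "x \<longlonglongrightarrow> 0" using attr[OF x(1)] small \<eta> by simp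
    hence "Bseq x" by (intro convergent_imp_Bseq convergentI)
    thus False using x(2) by blast
  qed
qed

theorem theorem4p3:
  fixes N :: nat and \<alpha> :: real
  assumes "N \<ge> 3" and "real N - 1 < \<alpha>" and "\<alpha> \<le> real N"
  shows "stability_region N \<alpha> = {}"
proof -
  have "2 < \<alpha>" using assms by linarith
  thus ?thesis
    using not_zero_attractive assms(3)
    by (auto simp: stability_region_def zero_asymptotically_stable_def)
qed

end
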